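(* Let $k\ge 1$, let $P\subseteq\mathbb{R}^k$ and let $f_P:P\to\mathbb{R}$ be a real-valued function. Then $f_P$ is monotonically extendible to $\mathbb{R}^k$ if and only if $f_P$ is separably increasing. Moreover, for every separably increasing $f_P$, every strictly increasing $u_1:\mathbb{R}^k\to\mathbb{R}$ satisfying $0<u_1(\mathbf{x})<1$ for all $\mathbf{x}\in\mathbb{R}^k$, and every $\alpha,\beta\in\mathbb{R}$ with $\alpha<\beta$, the function $f:\mathbb{R}^k\to\mathbb{R}$ defined by $$f(\mathbf{x})=\max\big\{a(\mathbf{x}),\,\min\{b(\mathbf{x}),\beta\}-\beta+\alpha\big\}\,\big(1-u_1(\mathbf{x})\big)+\min\big\{b(\mathbf{x}),\,\max\{a(\mathbf{x}),\alpha\}-\alpha+\beta\big\}\,u_1(\mathbf{x})$$ is a strictly increasing extension of $f_P$ to $\mathbb{R}^k$, i.e. $f$ coincides with $f_P$ on $P$ and is strictly increasing on $\mathbb{R}^k$.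
   Context: For $\mathbf{x},\mathbf{y}\in\mathbb{R}^k$: $\mathbf{x}\ge\mathbf{y}$ means $x_i\ge y_i$ for all $i\in\{1,\dots,k\}$; $\mathbf{x}>\mathbf{y}$ means $\mathbf{x}\ge\mathbf{y}$ and $\mathbf{x}\ne\mathbf{y}$; $\le$ and $<$ are the reverse relations. A real-valued function $g$ on a set $Q\subseteq\mathbb{R}^k$ is strictly increasing (on $Q$) if for all $\mathbf{x},\mathbf{y}\in Q$, $\mathbf{x}>\mathbf{y}$ implies $g(\mathbf{x})>g(\mathbf{y})$. $f_P$ is monotonically extendible to $\mathbb{R}^k$ if there is a strictly increasing $f:\mathbb{R}^k\to\mathbb{R}$ whose restriction to $P$ is $f_P$. Extended reals $\widetilde{\mathbb{R}}=\mathbb{R}\cup\{-\infty,+\infty\}$ carry the usual order, with $\sup\emptyset=-\infty$ and $\inf\emptyset=+\infty$, and for finite $c$, $\pm\infty+c=\pm\infty$. For $\mathbf{x}\in\mathbb{R}^k$ define, with values in $\widetilde{\mathbb{R}}$, $$a(\mathbf{x})=\sup\{f_P(\mathbf{y})\mid \mathbf{y}\le\mathbf{x},\ \mathbf{y}\in P\},\qquad b(\mathbf{x})=\inf\{f_P(\mathbf{z})\mid \mathbf{z}\ge\mathbf{x},\ \mathbf{z}\in P\}.$$ $f_P$ is separably increasing if for all $\mathbf{x},\mathbf{x}'\in\mathbb{R}^k$, $\mathbf{x}'>\mathbf{x}$ implies $b(\mathbf{x}')>a(\mathbf{x})$. (For separably increasing $f_P$, the max and min factors in the formula for $f$ are finite,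 so $f$ is well defined.) *)

theory Defs
  imports "HOL-Analysis.Analysis"
begin

text \<open>
  The library order on \<^typ>\<open>real^'k\<close> is the componentwise one, and its strict part
  is \<open>x \<le> y \<and> x \<noteq> y\<close> (not strict inequality in every component); thus
  \<^const>\<open>strict_mono_on\<close> is the intended notion of a strictly increasing function.
  A function on \<open>P\<close> is represented by a total function whose values outside \<open>P\<close> are never used.
\<close>

definition strictly_increasing_extension ::
  "(real^'k) set \<Rightarrow> (real^'k \<Rightarrow> real) \<Rightarrow> (real^'k \<Rightarrow> real) \<Rightarrow> bool" where
  "strictly_increasing_extension P f\<^sub>P f \<longleftrightarrow> (\<forall>x\<in>P. f x = f\<^sub>P x) \<and> strict_mono_on UNIV f"

definition monotonically_extendible :: "(real^'k) set \<Rightarrow> (real^'k \<Rightarrow> real) \<Rightarrow> bool" where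
  "monotonically_extendible P f\<^sub>P \<longleftrightarrow> (\<exists>f. strictly_increasing_extension P f\<^sub>P f)"

text \<open>In \<^typ>\<open>ereal\<close> the empty supremum is \<open>-\<infinity>\<close> and the empty infimum is \<open>+\<infinity>\<close>.\<close>

definition lower_env :: "(real^'k) set \<Rightarrow> (real^'k \<Rightarrow> real) \<Rightarrow> real^'k \<Rightarrow> ereal" where
  "lower_env P f\<^sub>P x = (SUP y\<in>{y\<in>P. y \<le> x}. ereal (f\<^sub>P y))"

definition upper_env :: "(real^'k) set \<Rightarrow> (real^'k \<Rightarrow> real) \<Rightarrow> real^'k \<Rightarrow> ereal" where
  "upper_env P f\<^sub>P x = (INF z\<in>{z\<in>P. z \<ge> x}. ereal (f\<^sub>P z))"

definition separably_increasing :: "(real^'k) set \<Rightarrow> (real^'k \<Rightarrow> real) \<Rightarrow> bool" where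
  "separably_increasing P f\<^sub>P \<longleftrightarrow>
     (\<forall>x x'. x' > x \<longrightarrow> upper_env P f\<^sub>P x' > lower_env P f\<^sub>P x)"

definition lower_factor ::
  "(real^'k) set \<Rightarrow> (real^'k \<Rightarrow> real) \<Rightarrow> real \<Rightarrow> real \<Rightarrow> real^'k \<Rightarrow> ereal" where
  "lower_factor P f\<^sub>P \<alpha> \<beta> x =
     max (lower_env P f\<^sub>P x) (min (upper_env P f\<^sub>P x) (ereal \<beta>) - ereal \<beta> + ereal \<alpha>)"

definition upper_factor ::
  "(real^'k) set \<Rightarrow> (real^'k \<Rightarrow> real) \<Rightarrow> real \<Rightarrow> real \<Rightarrow> real^'k \<Rightarrow> ereal" where
  "upper_factor P f\<^sub>P \<alpha> \<beta> x =
     min (upper_env P f\<^sub>P x) (max (lower_env P f\<^sub>P x) (ereal \<alpha>) - ereal \<alpha> + ereal \<beta>)"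

text \<open>
  \<^const>\<open>real_of_ereal\<close> sends \<open>\<plusminus>\<infinity>\<close> to \<open>0\<close>, so the following formula has its intended
  meaning only where both factors are finite.
\<close>

definition extension_formula ::
  "(real^'k) set \<Rightarrow> (real^'k \<Rightarrow> real) \<Rightarrow> (real^'k \<Rightarrow> real) \<Rightarrow> real \<Rightarrow> real \<Rightarrow> real^'k \<Rightarrow> real" where
  "extension_formula P f\<^sub>P u \<alpha> \<beta> x =
     real_of_ereal (lower_factor P f\<^sub>P \<alpha> \<beta> x) * (1 - u x) +
     real_of_ereal (upper_factor P f\<^sub>P \<alpha> \<beta> x) * u x"

end

theory Submission
  imports Defs
begin

text \<open>
  Write \<open>a\<close>, \<open>b\<close> for the two envelopes and \<open>L\<close>, \<open>U\<close> for the two factors of the formula,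
  so that the candidate extension is the convex combination \<open>(1 - u) L + u U\<close>.

  An extension \<open>f\<close> separates the envelopes: \<open>a(x) \<le> f(x) < f(x') \<le> b(x')\<close> whenever \<open>x < x'\<close>.
  Conversely, separation makes \<open>a < \<infinity>\<close>, \<open>b > -\<infinity>\<close> and \<open>a \<le> b\<close>, with \<open>a = b = f\<^sub>P\<close> on \<open>P\<close>.
  The factors truncate the possibly infinite envelopes by each other: \<open>L\<close> and \<open>U\<close> are finite,
  both inherit monotonicity from \<open>a\<close> and \<open>b\<close>, and they still satisfy \<open>L(x) \<le> U(x)\<close> and
  \<open>L(x) < U(x')\<close> for \<open>x < x'\<close>; here the shift by \<open>\<beta> - \<alpha> > 0\<close> keeps the truncations apart.
  Passing from \<open>x\<close> to \<open>x' > x\<close> then cannot decrease \<open>(1 - u) L + u U\<close>, because \<open>L\<close> and \<open>U\<close> do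
  not decrease and weight moves from the smaller to the larger of the two; it could stay
  constant only if \<open>L(x) = U(x) = U(x')\<close>, which \<open>L(x) < U(x')\<close> excludes.  On \<open>P\<close> both factors are
  \<open>f\<^sub>P\<close>.  Finally a suitable weight \<open>u\<close> exists, so separability does imply extendibility.
\<close>

lemma lower_env_mono: "x \<le> x' \<Longrightarrow> lower_env P f x \<le> lower_env P f x'"
  unfolding lower_env_def by (rule SUP_subset_mono) auto

lemma upper_env_mono: "x \<le> x' \<Longrightarrow> upper_env P f x \<le> upper_env P f x'"
  unfolding upper_env_def by (rule INF_superset_mono) auto

lemma le_lower_env: "y \<in> P \<Longrightarrow> y \<le> x \<Longrightarrow> ereal (f y) \<le> lower_env P f x"
  unfolding lower_env_def by (rule SUP_upper) auto

lemma upper_env_le: "z \<in> P \<Longrightarrow> x \<le> z \<Longrightarrow> upper_env P f x \<le> ereal (f z)"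
  unfolding upper_env_def by (rule INF_lower) auto

text \<open>
  The envelopes at \<open>x\<close> are compared through pairs \<open>y \<le> x \<le> z\<close> in \<open>P\<close>; separability, applied to
  the points \<open>y\<close> and \<open>z\<close> instead of \<open>x\<close>, orders the values of every such pair.
\<close>

lemma lower_env_le_upper_env:
  assumes "separably_increasing P f"
  shows "lower_env P f x \<le> upper_env P f x"
proof -
  have "ereal (f y) \<le> ereal (f z)" if "y \<in> P" "y \<le> x" "z \<in> P" "x \<le> z" for y z
  proof (cases "y = z")
    case False
    with that have "y < z" by (meson order.trans order.not_eq_order_implies_strict)
    then have "lower_env P f y < upper_env P f z"
      using assms by (auto simp: separably_increasing_def)
    with le_lower_env[OF \<open>y \<in> P\<close> order_refl] upper_env_le[OF \<open>z \<in> P\<close> order_refl]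
    show ?thesis by (meson order.trans less_imp_le)
  qed simp
  then show ?thesis
    unfolding lower_env_def upper_env_def by (intro SUP_least INF_greatest) auto
qed

lemma envs_eq_on_domain:
  assumes "separably_increasing P f" "x \<in> P"
  shows "lower_env P f x = ereal (f x)" "upper_env P f x = ereal (f x)"
  using lower_env_le_upper_env[OF assms(1), of x]
    le_lower_env[OF assms(2) order_refl, of f] upper_env_le[OF assms(2) order_refl, of f]
  by auto

text \<open>
  These bounds come from the existence of points strictly above and strictly below \<open>x\<close>, hence
  from \<open>\<real>\<^sup>k\<close> having positive dimension.  Monotonicity of \<open>f\<close> on \<open>P\<close> alone would not give them: \<open>f\<close>
  may increase to \<open>\<infinity>\<close> along points of \<open>P\<close> approaching some \<open>x\<close> outside \<open>P\<close> from below.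
\<close>

lemma envs_half_finite:
  fixes P :: "(real^'k) set"
  assumes "separably_increasing P f"
  shows "lower_env P f x < \<infinity>" "- \<infinity> < upper_env P f x"
proof -
  have "x < (\<chi> i. x $ i + 1)" "(\<chi> i. x $ i - 1) < x"
    by (auto simp: less_vec_def less_eq_vec_def vec_eq_iff not_le)
  then obtain y z where "x < z" "y < x" by blast
  with assms have "lower_env P f x < upper_env P f z" "lower_env P f y < upper_env P f x"
    unfolding separably_increasing_def by blast+
  then show "lower_env P f x < \<infinity>" "- \<infinity> < upper_env P f x"
    by auto
qed

lemma lower_factor_mono: "x \<le> x' \<Longrightarrow> lower_factor P f \<alpha> \<beta> x \<le> lower_factor P f \<alpha> \<beta> x'"
  unfolding lower_factor_def
  by (intro max.mono add_mono ereal_minus_mono min.mono lower_env_mono upper_env_mono order_refl)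

lemma upper_factor_mono: "x \<le> x' \<Longrightarrow> upper_factor P f \<alpha> \<beta> x \<le> upper_factor P f \<alpha> \<beta> x'"
  unfolding upper_factor_def
  by (intro max.mono add_mono ereal_minus_mono min.mono lower_env_mono upper_env_mono order_refl)

lemma factors_finite:
  assumes "separably_increasing P f"
  shows "\<bar>lower_factor P f \<alpha> \<beta> x\<bar> \<noteq> \<infinity>" "\<bar>upper_factor P f \<alpha> \<beta> x\<bar> \<noteq> \<infinity>"
  using envs_half_finite[OF assms, of x]
  by (cases "lower_env P f x"; cases "upper_env P f x";
      auto simp: lower_factor_def upper_factor_def max_def min_def)+

text \<open>
  Of the four comparisons hidden in \<open>max \<le> min\<close>, the one between the truncations holds because
  the first is at most \<open>\<alpha>\<close> and the second at least \<open>\<beta>\<close>; the other three reduce to \<open>a \<le> b\<close> and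
  \<open>\<alpha> < \<beta>\<close>.
\<close>

lemma lower_factor_le_upper_factor:
  assumes "separably_increasing P f" "\<alpha> < \<beta>"
  shows "lower_factor P f \<alpha> \<beta> x \<le> upper_factor P f \<alpha> \<beta> x"
  using envs_half_finite[OF assms(1), of x] lower_env_le_upper_env[OF assms(1), of x] assms(2)
  by (cases "lower_env P f x"; cases "upper_env P f x";
      auto simp: lower_factor_def upper_factor_def max_def min_def)

lemma lower_factor_less_upper_factor:
  assumes sep: "separably_increasing P f" and "\<alpha> < \<beta>" "x < x'"
  shows "lower_factor P f \<alpha> \<beta> x < upper_factor P f \<alpha> \<beta> x'"
proof -
  have "lower_env P f x < upper_env P f x'"
    using sep \<open>x < x'\<close> by (simp add: separably_increasing_def)
  moreover have "lower_env P f x \<le> lower_env P f x'" "upper_env P f x \<le> upper_env P f x'"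
    using \<open>x < x'\<close> by (simp_all add: lower_env_mono upper_env_mono)
  ultimately show ?thesis
    using envs_half_finite[OF sep, of x] envs_half_finite[OF sep, of x'] \<open>\<alpha> < \<beta>\<close>
    by (cases "lower_env P f x"; cases "upper_env P f x";
        cases "lower_env P f x'"; cases "upper_env P f x'";
        auto simp: lower_factor_def upper_factor_def max_def min_def)
qed

lemma factors_eq_on_domain:
  assumes "separably_increasing P f" "\<alpha> < \<beta>" "x \<in> P"
  shows "lower_factor P f \<alpha> \<beta> x = ereal (f x)" "upper_factor P f \<alpha> \<beta> x = ereal (f x)"
  using assms(2) envs_eq_on_domain[OF assms(1,3)]
  by (auto simp: lower_factor_def upper_factor_def max_def min_def)

lemma convex_combination_strict_mono:
  fixes l l' m m' u u' :: real
  assumes "l \<le> m" "l \<le> l'" "m \<le> m'" "l < m'" "0 < u'" "u' < 1" "u < u'"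
  shows "l * (1 - u) + m * u < l' * (1 - u') + m' * u'"
proof -
  have "(l' * (1 - u') + m' * u') - (l * (1 - u) + m * u)
      = (l' - l) * (1 - u') + (m' - m) * u' + (m - l) * (u' - u)"
    by algebra
  moreover have "0 \<le> (l' - l) * (1 - u')" "0 \<le> (m' - m) * u'" "0 \<le> (m - l) * (u' - u)"
    using assms by simp_all
  \<comment> \<open>As \<open>l < m'\<close>, at least one of the steps \<open>l \<le> m\<close> and \<open>m \<le> m'\<close> is strict.\<close>
  moreover have "0 < (m' - m) * u' \<or> 0 < (m - l) * (u' - u)"
    using assms by (cases "m < m'") auto
  ultimately show ?thesis by linarith
qed

lemma extension_formula_is_extension:
  assumes sep: "separably_increasing P f" and "\<alpha> < \<beta>"
    and u: "strict_mono_on UNIV u" "\<And>x. 0 < u x" "\<And>x. u x < 1"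
  shows "strictly_increasing_extension P f (extension_formula P f u \<alpha> \<beta>)"
  unfolding strictly_increasing_extension_def
proof (intro conjI ballI strict_mono_onI)
  fix x assume "x \<in> P"
  then show "extension_formula P f u \<alpha> \<beta> x = f x"
    using factors_eq_on_domain[OF sep \<open>\<alpha> < \<beta>\<close>]
    by (simp add: extension_formula_def algebra_simps)
next
  fix x x' :: "real^'a" assume "x < x'"
  let ?L = "lower_factor P f \<alpha> \<beta>" and ?U = "upper_factor P f \<alpha> \<beta>"
  define l m where "l = (\<lambda>x. real_of_ereal (?L x))" and "m = (\<lambda>x. real_of_ereal (?U x))"
  have L: "?L x = ereal (l x)" and U: "?U x = ereal (m x)" for x
    using factors_finite[OF sep, of \<alpha> \<beta> x] by (auto simp: l_def m_def ereal_real)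
  have "l x \<le> m x" "l x < m x'"
    using lower_factor_le_upper_factor[OF sep \<open>\<alpha> < \<beta>\<close>, of x]
      lower_factor_less_upper_factor[OF sep \<open>\<alpha> < \<beta>\<close> \<open>x < x'\<close>]
    by (simp_all add: L U)
  moreover have "l x \<le> l x'" "m x \<le> m x'"
    using lower_factor_mono[of x x' P f \<alpha> \<beta>] upper_factor_mono[of x x' P f \<alpha> \<beta>] \<open>x < x'\<close>
    by (simp_all add: L U)
  ultimately have "l x * (1 - u x) + m x * u x < l x' * (1 - u x') + m x' * u x'"
    using u strict_mono_onD[OF u(1) _ _ \<open>x < x'\<close>]
    by (intro convex_combination_strict_mono) auto
  then show "extension_formula P f u \<alpha> \<beta> x < extension_formula P f u \<alpha> \<beta> x'"
    by (simp add: extension_formula_def l_def m_def)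
qed

lemma monotonically_extendible_imp_separably_increasing:
  assumes "monotonically_extendible P f"
  shows "separably_increasing P f"
  unfolding separably_increasing_def
proof (intro allI impI)
  obtain g where g: "\<And>x. x \<in> P \<Longrightarrow> g x = f x" "strict_mono g"
    using assms by (auto simp: monotonically_extendible_def strictly_increasing_extension_def)
  fix x x' :: "real^'a" assume "x < x'"
  have "lower_env P f x \<le> ereal (g x)"
    unfolding lower_env_def using g strict_mono_mono[OF g(2)]
    by (intro SUP_least) (auto dest: monoD simp flip: g(1))
  also have "\<dots> < ereal (g x')"
    using g(2) \<open>x < x'\<close> by (simp add: strict_mono_def)
  also have "\<dots> \<le> upper_env P f x'"
    unfolding upper_env_def using g strict_mono_mono[OF g(2)]
    by (intro INF_greatest) (auto dest: monoD simp flip: g(1))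
  finally show "lower_env P f x < upper_env P f x'" .
qed

text \<open>The sum of the coordinates is strictly increasing; arctan squeezes it into a bounded interval.\<close>

lemma ex_strict_mono_between_0_1:
  "\<exists>u :: real^'k \<Rightarrow> real. strict_mono_on UNIV u \<and> (\<forall>x. 0 < u x \<and> u x < 1)"
proof (intro exI conjI allI strict_mono_onI)
  let ?u = "\<lambda>x :: real^'k. arctan (\<Sum>i\<in>UNIV. x $ i) / pi + 1 / 2"
  fix x y :: "real^'k"
  show "0 < ?u x" "?u x < 1"
    using arctan_bounded[of "\<Sum>i\<in>UNIV. x $ i"] by (simp_all add: field_simps)
  assume "x < y"
  then have "\<forall>i. x $ i \<le> y $ i" "\<exists>i. x $ i < y $ i"
    by (auto simp: less_vec_def less_eq_vec_def not_le)
  then have "(\<Sum>i\<in>UNIV. x $ i) < (\<Sum>i\<in>UNIV. y $ i)"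
    by (intro sum_strict_mono_ex1) auto
  then show "?u x < ?u y"
    by (simp add: divide_strict_right_mono arctan_less_iff)
qed

theorem theorem5:
  fixes P :: "(real^'k) set" and f\<^sub>P :: "real^'k \<Rightarrow> real"
  shows "(monotonically_extendible P f\<^sub>P \<longleftrightarrow> separably_increasing P f\<^sub>P) \<and>
    (separably_increasing P f\<^sub>P \<longrightarrow>
      (\<forall>(u\<^sub>1 :: real^'k \<Rightarrow> real) (\<alpha> :: real) (\<beta> :: real).
        strict_mono_on UNIV u\<^sub>1 \<and> (\<forall>x. 0 < u\<^sub>1 x \<and> u\<^sub>1 x < 1) \<and> \<alpha> < \<beta> \<longrightarrow>
          (\<forall>x. \<bar>lower_factor P f\<^sub>P \<alpha> \<beta> x\<bar> \<noteq> \<infinity> \<and> \<bar>upper_factor P f\<^sub>P \<alpha> \<beta> x\<bar> \<noteq> \<infinity>) \<and>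
          strictly_increasing_extension P f\<^sub>P (extension_formula P f\<^sub>P u\<^sub>1 \<alpha> \<beta>)))"
proof -
  have "monotonically_extendible P f\<^sub>P" if sep: "separably_increasing P f\<^sub>P"
  proof -
    obtain u :: "real^'k \<Rightarrow> real" where "strict_mono_on UNIV u" "\<forall>x. 0 < u x \<and> u x < 1"
      using ex_strict_mono_between_0_1 by blast
    then have "strictly_increasing_extension P f\<^sub>P (extension_formula P f\<^sub>P u 0 1)"
      using sep by (intro extension_formula_is_extension) auto
    then show ?thesis by (auto simp: monotonically_extendible_def)
  qed
  then show ?thesis
    using monotonically_extendible_imp_separably_increasing[of P f\<^sub>P]
    by (auto intro: extension_formula_is_extension simp: factors_finite)
qed

end
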